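(* Let $F=(f_1,f_2):\Omega\subset\mathbb R^2\to\mathbb R^2$ be differentiable in the sense of Fréchet over an open set $\Omega$, and let $\mathbb A=\mathbb A^2_{1,2}$. Then the components of $F$ satisfy on $\Omega$ the equations $$\frac{\partial f_1}{\partial x_2}=0,\qquad\frac{\partial f_2}{\partial x_1}=0$$ if and only if $F$ is $\mathbb A$-algebrizable.
   Context: $\mathbb A^2_{1,2}$ denotes $\mathbb R^2$ (canonical basis $e_1,e_2$) with the product $e_1e_1=e_1$, $e_2e_2=e_2$, $e_1e_2=e_2e_1=0$; its unit is $e=e_1+e_2$. $F$ is $\mathbb A$-algebrizable on $\Omega$ if there is a function $F':\Omega\to\mathbb R^2$ with $\lim_{\xi\to0}|F(w+\xi)-F(w)-F'(w)\xi|/|\xi|=0$ for all $w\in\Omega$, where $F'(w)\xi$ is the product in $\mathbb A$. *)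

theory Defs
  imports "HOL-Analysis.Analysis"
begin

(* Products of basis vectors e_i = axis i 1: e_1 e_1 = e_1, e_2 e_2 = e_2, e_1 e_2 = e_2 e_1 = 0. *)
definition A12_basis_mult :: "2 \<Rightarrow> 2 \<Rightarrow> real ^ 2" where
  "A12_basis_mult i j = (if i = j then axis i 1 else 0)"

(* The bilinear extension of the multiplication table. *)
definition A12_mult :: "real ^ 2 \<Rightarrow> real ^ 2 \<Rightarrow> real ^ 2" where
  "A12_mult x y = (\<Sum>i\<in>UNIV. \<Sum>j\<in>UNIV. (x $ i * y $ j) *\<^sub>R A12_basis_mult i j)"

lemma A12_mult_eq: "A12_mult x y = vector [x $ 1 * y $ 1, x $ 2 * y $ 2]"
  by (simp add: A12_mult_def A12_basis_mult_def vec_eq_iff forall_2 sum_2 axis_def)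

lemma A12_mult_basis: "A12_mult (axis i 1) (axis j 1) = A12_basis_mult i j"
  using exhaust_2[of i] exhaust_2[of j]
  by (auto simp: A12_mult_eq A12_basis_mult_def vec_eq_iff forall_2 axis_def)

lemma A12_mult_unit:
  "A12_mult (axis 1 1 + axis 2 1) x = x" "A12_mult x (axis 1 1 + axis 2 1) = x"
  by (simp_all add: A12_mult_eq vec_eq_iff forall_2 axis_def)

(* The value is meaningful only where the partial derivative exists (deriv is defined by choice). *)
definition partial_deriv :: "'n::finite \<Rightarrow> (real ^ 'n \<Rightarrow> real) \<Rightarrow> real ^ 'n \<Rightarrow> real" where
  "partial_deriv j f w = deriv (\<lambda>t. f (w + t *\<^sub>R axis j 1)) 0"

(* Only the values of F near points of S matter when S is open. *)
definition algebrizable_on ::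
  "(real ^ 2 \<Rightarrow> real ^ 2 \<Rightarrow> real ^ 2) \<Rightarrow> (real ^ 2 \<Rightarrow> real ^ 2) \<Rightarrow> (real ^ 2) set \<Rightarrow> bool" where
  "algebrizable_on prd F S \<longleftrightarrow>
    (\<exists>F' :: real ^ 2 \<Rightarrow> real ^ 2. \<forall>w\<in>S.
      ((\<lambda>\<xi>. norm (F (w + \<xi>) - F w - prd (F' w) \<xi>) / norm \<xi>) \<longlongrightarrow> 0) (at 0))"

end

theory Submission
  imports Defs
begin

text \<open>
  The limit that defines \<open>F' w\<close> says exactly that \<open>\<xi> \<mapsto> F' w \<xi>\<close> (product in the
  algebra) is the Frechet derivative of \<open>F\<close> at \<open>w\<close>, so algebrizability is a pointwise
  condition on the total derivative \<open>D\<close>: at every point, \<open>D\<close> must be a multiplication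
  operator of the algebra (\<open>algebrizable_on_A12_iff\<close>). Since the product is
  componentwise, the multiplication operators are the diagonal matrices, that is, the
  linear maps with vanishing off-diagonal entries (\<open>diagonal_iff_A12_mult\<close>). By the
  chain rule the entries of \<open>D\<close> are the partial derivatives of the components of \<open>F\<close>
  (\<open>partial_deriv_component\<close>), and the two off-diagonal ones are those in the equations.
\<close>

lemma partial_deriv_component:
  fixes F :: "real ^ 'n \<Rightarrow> real ^ 'm"
  assumes "(F has_derivative D) (at w)"
  shows "partial_deriv j (\<lambda>x. F x $ i) w = D (axis j 1) $ i"
proof -
  interpret D: bounded_linear D
    using assms by (rule has_derivative_bounded_linear)
  have line: "((\<lambda>t::real. w + t *\<^sub>R axis j 1) has_derivative (\<lambda>t. t *\<^sub>R axis j 1)) (at 0)"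
    by (auto intro!: derivative_eq_intros)
  have "((\<lambda>t. F (w + t *\<^sub>R axis j 1)) has_derivative (\<lambda>t. D (t *\<^sub>R axis j 1))) (at 0)"
    using has_derivative_compose[OF line, of F D] assms by simp
  then have "((\<lambda>t. F (w + t *\<^sub>R axis j 1) $ i) has_derivative
      (\<lambda>t. D (t *\<^sub>R axis j 1) $ i)) (at 0)"
    by (rule bounded_linear.has_derivative[OF bounded_linear_vec_nth])
  then have "((\<lambda>t. F (w + t *\<^sub>R axis j 1) $ i) has_field_derivative
      D (axis j 1) $ i) (at 0)"
    by (simp add: has_field_derivative_def D.scaleR mult.commute[of _ "D (axis j 1) $ i"])
  then show ?thesis
    unfolding partial_deriv_def by (rule DERIV_imp_deriv)
qed

lemma bounded_linear_A12_mult: "bounded_linear (A12_mult a)"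
proof -
  have "linear (A12_mult a)"
    by (rule linearI) (simp_all add: A12_mult_eq vec_eq_iff forall_2 algebra_simps)
  then show ?thesis
    by (simp add: linear_conv_bounded_linear)
qed

lemma algebrizable_on_A12_iff:
  "algebrizable_on A12_mult F S \<longleftrightarrow> (\<forall>w\<in>S. \<exists>a. (F has_derivative A12_mult a) (at w))"
  unfolding algebrizable_on_def has_derivative_at
  by (simp only: bounded_linear_A12_mult bchoice_iff simp_thms)

text \<open>
  The factor is found by evaluating at the unit: a linear map that multiplies by \<open>a\<close> sends
  \<open>e\<^sub>1 + e\<^sub>2\<close> to \<open>a\<close>, and the diagonal shape makes this candidate work on each basis vector.
\<close>
lemma diagonal_iff_A12_mult:
  assumes "linear D"
  shows "D (axis 2 1) $ 1 = 0 \<and> D (axis 1 1) $ 2 = 0 \<longleftrightarrow> (\<exists>a. D = A12_mult a)"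
proof
  assume diag: "D (axis 2 1) $ 1 = 0 \<and> D (axis 1 1) $ 2 = 0"
  have "D x = A12_mult (D (axis 1 1 + axis 2 1)) x" for x
  proof -
    have "x = x $ 1 *\<^sub>R axis 1 1 + x $ 2 *\<^sub>R axis 2 1"
      by (simp add: vec_eq_iff forall_2 axis_def)
    then have "D x = D (x $ 1 *\<^sub>R axis 1 1 + x $ 2 *\<^sub>R axis 2 1)"
      by (rule arg_cong)
    also have "\<dots> = x $ 1 *\<^sub>R D (axis 1 1) + x $ 2 *\<^sub>R D (axis 2 1)"
      using assms by (simp add: linear_add linear_scale)
    also have "\<dots> = A12_mult (D (axis 1 1 + axis 2 1)) x"
      using assms diag by (simp add: A12_mult_eq vec_eq_iff forall_2 linear_add)
    finally show ?thesis .
  qed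
  then show "\<exists>a. D = A12_mult a"
    by blast
next
  assume "\<exists>a. D = A12_mult a"
  then show "D (axis 2 1) $ 1 = 0 \<and> D (axis 1 1) $ 2 = 0"
    by (auto simp: A12_mult_eq axis_def)
qed

theorem theorem2p2:
  fixes F :: "real ^ 2 \<Rightarrow> real ^ 2" and \<Omega> :: "(real ^ 2) set"
  assumes "open \<Omega>"
    and "\<And>w. w \<in> \<Omega> \<Longrightarrow> F differentiable (at w)"
  shows "(\<forall>w\<in>\<Omega>. partial_deriv 2 (\<lambda>x. F x $ 1) w = 0 \<and> partial_deriv 1 (\<lambda>x. F x $ 2) w = 0)
    \<longleftrightarrow> algebrizable_on A12_mult F \<Omega>"
  unfolding algebrizable_on_A12_iff
proof (rule ball_cong[OF refl])
  fix w assume "w \<in> \<Omega>"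
  then obtain D where D: "(F has_derivative D) (at w)"
    using assms(2) unfolding differentiable_def by blast
  have "partial_deriv 2 (\<lambda>x. F x $ 1) w = 0 \<and> partial_deriv 1 (\<lambda>x. F x $ 2) w = 0
      \<longleftrightarrow> (\<exists>a. D = A12_mult a)"
    using diagonal_iff_A12_mult[OF has_derivative_linear[OF D]]
    by (simp add: partial_deriv_component[OF D])
  also have "\<dots> \<longleftrightarrow> (\<exists>a. (F has_derivative A12_mult a) (at w))"
    using D by (blast dest: has_derivative_unique[OF D])
  finally show "partial_deriv 2 (\<lambda>x. F x $ 1) w = 0 \<and> partial_deriv 1 (\<lambda>x. F x $ 2) w = 0
      \<longleftrightarrow> (\<exists>a. (F has_derivative A12_mult a) (at w))" .
qed

end
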